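(* Let $E$ be a JB$^*$-triple and let $e,u$ be two tripotents in $E$. Then the following implications hold: $$u\le e\Rightarrow u\le_re\Rightarrow u\le_ce,\qquad u\le_he\Rightarrow u\le_{hc}e\Rightarrow u\le_ne,\qquad u\le_{h,t}e\Rightarrow u\le_{hc,t}e\Rightarrow u\le_{n,t}e\Rightarrow u\le_2e,$$ $$u\le_re\Rightarrow u\le_he,\quad u\le_ce\Rightarrow u\le_{hc}e,\quad u\le_he\Rightarrow u\le_{h,t}e,\quad u\le_{hc}e\Rightarrow u\le_{hc,t}e,\quad u\le_ne\Rightarrow u\le_{n,t}e.$$ Moreover, if $E$ is a JB$^*$-algebra and $e,u\in E$ are projections, then all the relations $u\le e$, $u\le_re$, $u\le_ce$, $u\le_he$, $u\le_{hc}e$, $u\le_ne$, $u\le_{h,t}e$, $u\le_{hc,t}e$, $u\le_{n,t}e$, $u\le_2e$ are equivalent.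
   Context: A JB$^*$-triple is a complex Banach space $E$ with a continuous map $\{\cdot,\cdot,\cdot\}:E^3\to E$ (triple product), symmetric and bilinear in the outer variables and conjugate linear in the middle one, such that (a) $\{x,y,\{a,b,c\}\}=\{\{x,y,a\},b,c\}-\{a,\{y,x,b\},c\}+\{a,b,\{x,y,c\}\}$; (b) for each $a\in E$ the operator $x\mapsto\{a,a,x\}$ is hermitian (i.e. $\|e^{i\alpha T}\|=1$ for all $\alpha\in\mathbb R$) with non-negative spectrum; (c) $\|\{x,x,x\}\|=\|x\|^3$. A JB$^*$-algebra $(B,\circ,* )$ is a JB$^*$-triple with $\{x,y,z\}=(x\circ y^* )\circ z+x\circ(y^*\circ z)-(x\circ z)\circ y^*$; a projection in it is $p$ with $p=p^*=p\circ p$. A tripotent is $e\in E$ with $\{e,e,e\}=e$. Put $E_2(e)=\{x\in E:\{e,e,x\}=x\}$. Tripotents $e,u$ are orthogonal if $\{e,u,x\}=0$ for all $x\in E$. A complex unit is $\alpha\in\mathbb C$ with $|\alpha|=1$. For tripotents $u,e$: - $u\le e$ iff $e-u$ is a tripotent orthogonal to $u$; - $u\le_r e$ iff $u\le e$ or $-u\le e$; - $u\le_c e$ iff $\alpha u\le e$ for some complex unit $\alpha$; - $u\le_h e$ iff $u=\{e,u,e\}$; - $u\le_{hc}e$ iff $\alpha u\le_h e$ for some complex unit $\alpha$; - $u\le_n e$ iff $u=\{e,e,u\}$ and $\{u,u,e\}$ is a tripotent; - $u\le_2 e$ iff $u\in E_2(e)$; - for $\kappa\in\{h,hc,n\}$,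 $u\le_{\kappa,t}e$ iff there are tripotents $e=v_0,\dots,v_k=u$ in $E$ with $v_j\le_\kappa v_{j-1}$ for $j=1,\dots,k$. *)

theory Defs
  imports "HOL-Analysis.Analysis"
begin

text \<open>
  A complex Banach space is carried by a real Banach type together with a complex scalar
  multiplication that extends the real one and is compatible with the norm.
\<close>

locale complex_banach_space = vector_space cscale
  for cscale :: "complex \<Rightarrow> 'a::banach \<Rightarrow> 'a" +
  assumes scale_of_real: "cscale (complex_of_real r) x = r *\<^sub>R x"
    and norm_scale: "norm (cscale c x) = cmod c * norm x"

text \<open>
  The operator exponential \<open>exp A = (\<Sum>n. A\<^sup>n / n!)\<close>, evaluated pointwise; for bounded \<open>A\<close> the
  series converges in operator norm, so this is the usual exponential. (The type of bounded
  linear operators is not an instance of the Banach algebra classes on which \<open>exp\<close> is defined.)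
\<close>

definition op_exp :: "('a::real_normed_vector \<Rightarrow> 'a) \<Rightarrow> 'a \<Rightarrow> 'a" where
  "op_exp A x = (\<Sum>n. (A ^^ n) x /\<^sub>R fact n)"

definition hermitian_op :: "(complex \<Rightarrow> 'a::real_normed_vector \<Rightarrow> 'a) \<Rightarrow> ('a \<Rightarrow> 'a) \<Rightarrow> bool" where
  "hermitian_op cscale A \<longleftrightarrow>
     (\<forall>\<alpha>::real. onorm (op_exp (\<lambda>x. cscale (\<i> * complex_of_real \<alpha>) (A x))) = 1)"

text \<open>The spectrum in the algebra of bounded complex-linear operators.\<close>

definition op_spectrum :: "(complex \<Rightarrow> 'a::real_normed_vector \<Rightarrow> 'a) \<Rightarrow> ('a \<Rightarrow> 'a) \<Rightarrow> complex set" where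
  "op_spectrum cscale A =
     {l. \<not> (\<exists>S. bounded_linear S \<and> Vector_Spaces.linear cscale cscale S \<and>
               (\<forall>x. S (cscale l x - A x) = x) \<and> (\<forall>x. cscale l (S x) - A (S x) = x))}"

locale jbstar_triple = complex_banach_space cscale
  for cscale :: "complex \<Rightarrow> 'a::banach \<Rightarrow> 'a" +
  fixes triple :: "'a \<Rightarrow> 'a \<Rightarrow> 'a \<Rightarrow> 'a"
  assumes triple_continuous: "continuous_on UNIV (\<lambda>(x, y, z). triple x y z)"
    and triple_sym: "triple x y z = triple z y x"
    and triple_linear: "Vector_Spaces.linear cscale cscale (\<lambda>x. triple x y z)"
    and triple_add_middle: "triple x (y + y') z = triple x y z + triple x y' z"
    and triple_scale_middle: "triple x (cscale \<gamma> y) z = cscale (cnj \<gamma>) (triple x y z)"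
    and jordan_identity:
      "triple x y (triple a b c) =
         triple (triple x y a) b c - triple a (triple y x b) c + triple a b (triple x y c)"
    and triple_hermitian: "hermitian_op cscale (\<lambda>x. triple a a x)"
    and triple_spectrum: "op_spectrum cscale (\<lambda>x. triple a a x) \<subseteq> \<real>\<^sub>\<ge>\<^sub>0"
    and triple_norm: "norm (triple x x x) = norm x ^ 3"

definition jordan_triple ::
  "('a \<Rightarrow> 'a \<Rightarrow> 'a) \<Rightarrow> ('a \<Rightarrow> 'a) \<Rightarrow> 'a \<Rightarrow> 'a \<Rightarrow> 'a \<Rightarrow> 'a::ab_group_add" where
  "jordan_triple jmult star x y z =
     jmult (jmult x (star y)) z + jmult x (jmult (star y) z) - jmult (jmult x z) (star y)"

text \<open>
  JB*-algebras: complex Jordan--Banach algebras with an involution. The last axiom is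
  \<open>\<parallel>U\<^sub>x(x\<^sup>*)\<parallel> = \<parallel>x\<parallel>\<^sup>3\<close>, since \<open>U\<^sub>x(y\<^sup>*) = {x, y, x}\<close>.
\<close>

locale jbstar_algebra = complex_banach_space cscale
  for cscale :: "complex \<Rightarrow> 'a::banach \<Rightarrow> 'a" +
  fixes jmult :: "'a \<Rightarrow> 'a \<Rightarrow> 'a"
    and star :: "'a \<Rightarrow> 'a"
  assumes jmult_commute: "jmult x y = jmult y x"
    and jmult_linear: "Vector_Spaces.linear cscale cscale (\<lambda>x. jmult x y)"
    and jmult_jordan: "jmult (jmult x y) (jmult x x) = jmult x (jmult y (jmult x x))"
    and norm_jmult: "norm (jmult x y) \<le> norm x * norm y"
    and star_add: "star (x + y) = star x + star y"
    and star_scale: "star (cscale c x) = cscale (cnj c) (star x)"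
    and star_star: "star (star x) = x"
    and star_jmult: "star (jmult x y) = jmult (star y) (star x)"
    and norm_jordan_triple: "norm (jordan_triple jmult star x x x) = norm x ^ 3"

definition jprojection :: "('a \<Rightarrow> 'a \<Rightarrow> 'a) \<Rightarrow> ('a \<Rightarrow> 'a) \<Rightarrow> 'a \<Rightarrow> bool" where
  "jprojection jmult star p \<longleftrightarrow> p = star p \<and> p = jmult p p"

definition tripotent :: "('a \<Rightarrow> 'a \<Rightarrow> 'a \<Rightarrow> 'a) \<Rightarrow> 'a \<Rightarrow> bool" where
  "tripotent T e \<longleftrightarrow> T e e e = e"

definition peirce2 :: "('a \<Rightarrow> 'a \<Rightarrow> 'a \<Rightarrow> 'a) \<Rightarrow> 'a \<Rightarrow> 'a set" where
  "peirce2 T e = {x. T e e x = x}"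

definition tri_orthogonal :: "('a \<Rightarrow> 'a \<Rightarrow> 'a \<Rightarrow> 'a::zero) \<Rightarrow> 'a \<Rightarrow> 'a \<Rightarrow> bool" where
  "tri_orthogonal T e u \<longleftrightarrow> (\<forall>x. T e u x = 0)"

text \<open>
  The relations below are meant for tripotents; in each of them the argument order is that
  of \<open>u \<le> e\<close>.
\<close>

definition tri_le :: "('a \<Rightarrow> 'a \<Rightarrow> 'a \<Rightarrow> 'a::ab_group_add) \<Rightarrow> 'a \<Rightarrow> 'a \<Rightarrow> bool" where
  "tri_le T u e \<longleftrightarrow> tripotent T (e - u) \<and> tri_orthogonal T (e - u) u"

definition tri_le_r :: "('a \<Rightarrow> 'a \<Rightarrow> 'a \<Rightarrow> 'a::ab_group_add) \<Rightarrow> 'a \<Rightarrow> 'a \<Rightarrow> bool" where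
  "tri_le_r T u e \<longleftrightarrow> tri_le T u e \<or> tri_le T (- u) e"

definition tri_le_c ::
  "(complex \<Rightarrow> 'a \<Rightarrow> 'a) \<Rightarrow> ('a \<Rightarrow> 'a \<Rightarrow> 'a \<Rightarrow> 'a::ab_group_add) \<Rightarrow> 'a \<Rightarrow> 'a \<Rightarrow> bool" where
  "tri_le_c cscale T u e \<longleftrightarrow> (\<exists>\<alpha>. cmod \<alpha> = 1 \<and> tri_le T (cscale \<alpha> u) e)"

definition tri_le_h :: "('a \<Rightarrow> 'a \<Rightarrow> 'a \<Rightarrow> 'a) \<Rightarrow> 'a \<Rightarrow> 'a \<Rightarrow> bool" where
  "tri_le_h T u e \<longleftrightarrow> u = T e u e"

definition tri_le_hc ::
  "(complex \<Rightarrow> 'a \<Rightarrow> 'a) \<Rightarrow> ('a \<Rightarrow> 'a \<Rightarrow> 'a \<Rightarrow> 'a) \<Rightarrow> 'a \<Rightarrow> 'a \<Rightarrow> bool" where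
  "tri_le_hc cscale T u e \<longleftrightarrow> (\<exists>\<alpha>. cmod \<alpha> = 1 \<and> tri_le_h T (cscale \<alpha> u) e)"

definition tri_le_n :: "('a \<Rightarrow> 'a \<Rightarrow> 'a \<Rightarrow> 'a) \<Rightarrow> 'a \<Rightarrow> 'a \<Rightarrow> bool" where
  "tri_le_n T u e \<longleftrightarrow> u = T e e u \<and> tripotent T (T u u e)"

definition tri_le_2 :: "('a \<Rightarrow> 'a \<Rightarrow> 'a \<Rightarrow> 'a) \<Rightarrow> 'a \<Rightarrow> 'a \<Rightarrow> bool" where
  "tri_le_2 T u e \<longleftrightarrow> u \<in> peirce2 T e"

text \<open>Transitive version of a relation \<open>R\<close>: all members of the chain have to be tripotents.\<close>

definition tri_chain ::
  "('a \<Rightarrow> 'a \<Rightarrow> 'a \<Rightarrow> 'a) \<Rightarrow> ('a \<Rightarrow> 'a \<Rightarrow> bool) \<Rightarrow> 'a \<Rightarrow> 'a \<Rightarrow> bool" where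
  "tri_chain T R u e \<longleftrightarrow>
     (\<exists>(k::nat) v. v 0 = e \<and> v k = u \<and> (\<forall>j\<le>k. tripotent T (v j)) \<and>
                   (\<forall>j\<in>{1..k}. R (v j) (v (j - 1))))"

definition tri_le_ht :: "('a \<Rightarrow> 'a \<Rightarrow> 'a \<Rightarrow> 'a) \<Rightarrow> 'a \<Rightarrow> 'a \<Rightarrow> bool" where
  "tri_le_ht T = tri_chain T (tri_le_h T)"

definition tri_le_hct ::
  "(complex \<Rightarrow> 'a \<Rightarrow> 'a) \<Rightarrow> ('a \<Rightarrow> 'a \<Rightarrow> 'a \<Rightarrow> 'a) \<Rightarrow> 'a \<Rightarrow> 'a \<Rightarrow> bool" where
  "tri_le_hct cscale T = tri_chain T (tri_le_hc cscale T)"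

definition tri_le_nt :: "('a \<Rightarrow> 'a \<Rightarrow> 'a \<Rightarrow> 'a) \<Rightarrow> 'a \<Rightarrow> 'a \<Rightarrow> bool" where
  "tri_le_nt T = tri_chain T (tri_le_n T)"

end

theory Submission
  imports Defs
begin

text \<open>
  Write \<open>Q x y = {x, y, x}\<close>. The Jordan identity implies the fundamental formula
  \<open>Q (Q x y) = Q x \<circ> Q y \<circ> Q x\<close>, from which the two substantial implications follow. The Peirce
  space \<open>E\<^sub>2(e)\<close> is the range of \<open>Q e\<close>, so the fundamental formula makes \<open>\<le>\<^sub>2\<close> transitive. If \<open>w\<close> is
  a tripotent with \<open>Q e w = w\<close>, then \<open>p = {w, w, e}\<close> equals \<open>Q w e\<close>, both \<open>Q e\<close> and \<open>Q w\<close> fix \<open>p\<close>,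
  and therefore \<open>{p, p, p} = Q (Q w e) p = Q w (Q e (Q w p)) = p\<close>.
  For projections, \<open>u \<le>\<^sub>2 e\<close> means \<open>e \<odot> u = u\<close>; the linearised Jordan axiom then shows that
  multiplication by \<open>u\<close> commutes with multiplication by \<open>e - u\<close>, which is the orthogonality needed
  for \<open>u \<le> e\<close>.
\<close>

section \<open>Jordan triple systems\<close>

locale jordan_triple_system =
  fixes triple :: "'a \<Rightarrow> 'a \<Rightarrow> 'a \<Rightarrow> 'a::real_vector"
  assumes triple_commute: "triple x y z = triple z y x"
    and linear_left: "linear (\<lambda>x. triple x y z)"
    and linear_middle: "linear (\<lambda>y. triple x y z)"
    and main_identity:
      "triple x y (triple a b c) =
         triple (triple x y a) b c - triple a (triple y x b) c + triple a b (triple x y c)"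
begin

lemma linear_right: "linear (triple x y)"
  using linear_left[of y x] by (simp add: triple_commute[of _ y x])

lemmas triple_diff_left = linear_diff[OF linear_left]
  and triple_minus =
    linear_neg[OF linear_left] linear_neg[OF linear_middle] linear_neg[OF linear_right]

lemma twist_by_involution:
  assumes "linear \<phi>" and involution: "\<And>x. \<phi> (\<phi> x) = x"
    and automorphism: "\<And>x y z. \<phi> (triple x y z) = triple (\<phi> x) (\<phi> y) (\<phi> z)"
  shows "jordan_triple_system (\<lambda>x y z. triple x (\<phi> y) z)"
proof (rule jordan_triple_system.intro)
  show "linear (\<lambda>y. triple x (\<phi> y) z)" for x z
    using linear_compose[OF assms(1) linear_middle] by (simp add: o_def)
  show "triple x (\<phi> y) (triple a (\<phi> b) c) =
      triple (triple x (\<phi> y) a) (\<phi> b) c - triple a (\<phi> (triple y (\<phi> x) b)) c +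
      triple a (\<phi> b) (triple x (\<phi> y) c)" for x y a b c
    by (simp add: automorphism involution main_identity[of x "\<phi> y"])
qed (rule triple_commute linear_left)+

subsection \<open>The fundamental formula\<close>

abbreviation quad :: "'a \<Rightarrow> 'a \<Rightarrow> 'a" where
  "quad x y \<equiv> triple x y x"

lemma triple_quad_swap: "triple x y (quad x z) = triple x z (quad x y)"
  and triple_quad: "triple x y (quad x z) = quad x (triple y x z)"
proof -
  define a b c where
    "a = triple x y (quad x z)" and "b = triple x z (quad x y)" and "c = quad x (triple y x z)"
  have a_eq: "a = b + b - c"
    using main_identity[of x y x z x] triple_commute[of "quad x y" z x]
    by (simp add: a_def b_def c_def)
  have b_eq: "b = a + a - c"
    using main_identity[of x z x y x] triple_commute[of "quad x z" y x] triple_commute[of z x y]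
    by (simp add: a_def b_def c_def)
  have "3 *\<^sub>R (a - b) = (a - b) + 2 *\<^sub>R (a - b)"
    using scaleR_add_left[of 1 2 "a - b"] by simp
  also have "\<dots> = (a - (b + b - c)) - (b - (a + a - c))"
    by (simp add: scaleR_2)
  also have "\<dots> = 0"
    by (simp flip: a_eq b_eq)
  finally have "a = b"
    by simp
  moreover from this a_eq have "a = c"
    by (simp add: algebra_simps)
  ultimately show "triple x y (quad x z) = triple x z (quad x y)"
    and "triple x y (quad x z) = quad x (triple y x z)"
    by (simp_all only: a_def b_def c_def)
qed

lemma fundamental_formula: "quad (quad x y) z = quad x (quad y (quad x z))"
proof -
  define q where "q = quad x y"
  have "quad q z =
      triple x y (triple x z q) + triple x (triple y x z) q - triple x z (triple x y q)"
    using main_identity[of x y x z q] by (simp add: q_def)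
  also have "\<dots> = quad x (triple y x (triple z x y)) + quad x (triple (triple y x z) x y)
      - quad x (triple z x (quad y x))"
    by (simp only: q_def triple_quad)
  also have "\<dots> = quad x (triple y x (triple z x y) + triple (triple y x z) x y
      - triple z x (quad y x))"
    by (simp only: linear_add[OF linear_middle] linear_diff[OF linear_middle])
  also have "triple y x (triple z x y) + triple (triple y x z) x y - triple z x (quad y x)
      = quad y (quad x z)"
    using main_identity[of z x y x y] by (simp add: triple_commute[of y x z])
  finally show ?thesis
    by (simp only: q_def)
qed

subsection \<open>Peirce 2-spaces\<close>

lemma quad_in_peirce2:
  assumes "tripotent triple e"
  shows "quad e x \<in> peirce2 triple e"
  using triple_quad_swap[of e e x] assms by (simp add: peirce2_def tripotent_def)

lemma quad_quad_peirce2: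
  assumes "tripotent triple e" and "x \<in> peirce2 triple e"
  shows "quad e (quad e x) = x"
  using main_identity[of x e e e e] assms triple_commute[of x e e]
  by (simp add: peirce2_def tripotent_def)

lemma peirce2_eq_range_quad:
  assumes "tripotent triple e"
  shows "peirce2 triple e = range (quad e)"
  using quad_in_peirce2[OF assms] quad_quad_peirce2[OF assms] by (auto intro: range_eqI[OF sym])

lemma range_quad_mono:
  assumes "v \<in> range (quad e)"
  shows "range (quad v) \<subseteq> range (quad e)"
  using assms by (auto simp: fundamental_formula)

lemma tri_le_2_trans:
  assumes "tripotent triple e" and "tripotent triple v"
    and "tri_le_2 triple u v" and "tri_le_2 triple v e"
  shows "tri_le_2 triple u e"
  using assms range_quad_mono[of v e] by (auto simp: tri_le_2_def peirce2_eq_range_quad)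

text \<open>In the Jordan algebra \<open>E\<^sub>2(e)\<close> with product \<open>{x, e, y}\<close>, the element \<open>quad w e\<close> is the square
  of \<open>w\<close>.\<close>

lemma tri_le_h_quad_square:
  assumes "tripotent triple e" and "tri_le_h triple w e"
  shows "quad e (quad w e) = quad w e"
  using fundamental_formula[of e w e] assms by (simp add: tripotent_def tri_le_h_def)

lemma tri_le_h_square:
  assumes "tripotent triple e" and "tri_le_h triple w e"
  shows "triple w w e = quad w e"
  using triple_quad[of e w w] tri_le_h_quad_square[OF assms] assms(2) triple_commute[of e w w]
  by (simp add: tri_le_h_def)

lemma tripotent_square:
  assumes e: "tripotent triple e" and w: "tripotent triple w" and w_le_e: "tri_le_h triple w e"
  shows "tripotent triple (triple w w e)"
proof -
  note square = tri_le_h_square[OF e w_le_e]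
  define p where "p = quad w e"
  have "quad w p = triple w w p"
    using triple_quad[of w w e] by (simp add: p_def square)
  also have "\<dots> = p"
    using quad_in_peirce2[OF w, of e] by (simp add: p_def peirce2_def)
  finally have "quad w p = p" .
  moreover have "quad e p = p"
    by (simp add: p_def tri_le_h_quad_square[OF e w_le_e])
  moreover have "quad p p = quad w (quad e (quad w p))"
    using fundamental_formula[of w e p] by (simp add: p_def)
  ultimately show ?thesis
    by (simp add: tripotent_def p_def square)
qed

end

section \<open>Relations between tripotents\<close>

lemma tri_chain_iff_rtranclp:
  fixes u e :: 'a
  shows "tri_chain T R u e \<longleftrightarrow>
     tripotent T e \<and> (\<lambda>x y. tripotent T x \<and> tripotent T y \<and> R y x)\<^sup>*\<^sup>* e u"
  (is "_ \<longleftrightarrow> _ \<and> ?step\<^sup>*\<^sup>* e u")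
proof
  assume "tri_chain T R u e"
  then obtain k and v :: "nat \<Rightarrow> 'a" where v: "v 0 = e" "v k = u" "\<forall>j\<le>k. tripotent T (v j)"
    "\<forall>j\<in>{1..k}. R (v j) (v (j - 1))"
    unfolding tri_chain_def by blast
  have "?step (v j) (v (Suc j))" if "j < k" for j
    using v(3) bspec[OF v(4), of "Suc j"] that by simp
  with v(1,2) have "(?step ^^ k) e u"
    unfolding relpowp_fun_conv by blast
  then show "tripotent T e \<and> ?step\<^sup>*\<^sup>* e u"
    using v(1,3) by (auto intro: relpowp_imp_rtranclp)
next
  assume chain: "tripotent T e \<and> ?step\<^sup>*\<^sup>* e u"
  then obtain k where "(?step ^^ k) e u"
    by (blast dest: rtranclp_imp_relpowp)
  then obtain v where v: "v 0 = e" "v k = u" "\<And>j. j < k \<Longrightarrow> ?step (v j) (v (Suc j))"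
    unfolding relpowp_fun_conv by blast
  have "tripotent T (v j)" if "j \<le> k" for j
    using that chain v(1) v(3)[of "j - 1"] by (cases j) auto
  moreover have "R (v j) (v (j - 1))" if "j \<in> {1..k}" for j
    using that v(3)[of "j - 1"] by (cases j) auto
  ultimately show "tri_chain T R u e"
    using v(1,2) unfolding tri_chain_def by blast
qed

lemma tri_chain_mono:
  assumes "tri_chain T R u e"
    and "\<And>x y. tripotent T x \<Longrightarrow> tripotent T y \<Longrightarrow> R x y \<Longrightarrow> R' x y"
  shows "tri_chain T R' u e"
  using assms unfolding tri_chain_iff_rtranclp by (auto elim!: mono_rtranclp[rule_format, rotated])

lemma tri_chain_single:
  assumes "tripotent T u" and "tripotent T e" and "R u e"
  shows "tri_chain T R u e"
  using assms unfolding tri_chain_iff_rtranclp by blast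

lemma tri_le_imp_tri_le_r: "tri_le T u e \<Longrightarrow> tri_le_r T u e"
  by (simp add: tri_le_r_def)

context jordan_triple_system
begin

lemma tri_le_imp_tri_le_h:
  assumes "tripotent triple u" and "tri_le triple u e"
  shows "tri_le_h triple u e"
proof -
  have replace_e: "triple e u x = triple u u x" for x
    using assms(2) by (simp add: tri_le_def tri_orthogonal_def triple_diff_left)
  have "triple e u e = triple e u u"
    by (simp only: replace_e triple_commute)
  also have "\<dots> = u"
    using assms(1) by (simp add: replace_e tripotent_def)
  finally show ?thesis
    by (simp add: tri_le_h_def)
qed

lemma tri_le_r_imp_tri_le_h:
  assumes "tripotent triple u" and "tri_le_r triple u e"
  shows "tri_le_h triple u e"
  using assms tri_le_imp_tri_le_h[of u e] tri_le_imp_tri_le_h[of "- u" e]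
  by (auto simp: tri_le_r_def tri_le_h_def tripotent_def triple_minus)

lemma tri_le_h_imp_tri_le_n:
  assumes "tripotent triple u" and "tripotent triple e" and "tri_le_h triple u e"
  shows "tri_le_n triple u e"
  using assms quad_in_peirce2[of e u] tripotent_square[of e u]
  by (simp add: tri_le_n_def tri_le_h_def peirce2_def)

lemma tri_le_n_imp_tri_le_2: "tri_le_n triple u e \<Longrightarrow> tri_le_2 triple u e"
  by (simp add: tri_le_n_def tri_le_2_def peirce2_def)

lemma tri_le_2_refl: "tripotent triple e \<Longrightarrow> tri_le_2 triple e e"
  by (simp add: tri_le_2_def peirce2_def tripotent_def)

lemma tri_le_nt_imp_tri_le_2:
  assumes "tri_le_nt triple u e"
  shows "tri_le_2 triple u e"
proof -
  have e: "tripotent triple e"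
    and "(\<lambda>x y. tripotent triple x \<and> tripotent triple y \<and> tri_le_n triple y x)\<^sup>*\<^sup>* e u"
    using assms by (simp_all add: tri_le_nt_def tri_chain_iff_rtranclp)
  from this(2) show ?thesis
  proof (induction rule: rtranclp_induct)
    case base
    show ?case by (rule tri_le_2_refl[OF e])
  next
    case (step v u)
    then show ?case
      using tri_le_2_trans[OF e] tri_le_n_imp_tri_le_2 by blast
  qed
qed

end

locale complex_jordan_triple_system = jordan_triple_system triple + vector_space cscale
  for cscale :: "complex \<Rightarrow> 'a \<Rightarrow> 'a::real_vector"
    and triple :: "'a \<Rightarrow> 'a \<Rightarrow> 'a \<Rightarrow> 'a" +
  assumes scale_left: "triple (cscale c x) y z = cscale c (triple x y z)"
    and scale_middle: "triple x (cscale c y) z = cscale (cnj c) (triple x y z)"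
begin

lemma scale_right: "triple x y (cscale c z) = cscale c (triple x y z)"
  by (metis scale_left triple_commute)

lemma triple_scale_unit:
  assumes "cmod \<alpha> = 1"
  shows "triple (cscale \<alpha> x) (cscale \<alpha> y) z = triple x y z"
proof -
  have "\<alpha> * cnj \<alpha> = 1"
    using assms by (simp add: complex_norm_square[symmetric])
  then show ?thesis
    by (simp add: scale_left scale_middle mult.commute)
qed

lemma tripotent_scale_unit:
  assumes "cmod \<alpha> = 1" and "tripotent triple u"
  shows "tripotent triple (cscale \<alpha> u)"
  using assms by (simp add: tripotent_def triple_scale_unit scale_right)

lemma tri_le_n_scale_unit:
  assumes "cmod \<alpha> = 1"
  shows "tri_le_n triple (cscale \<alpha> u) e \<longleftrightarrow> tri_le_n triple u e"
proof -
  have "\<alpha> \<noteq> 0"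
    using assms by auto
  then show ?thesis
    using assms by (simp add: tri_le_n_def triple_scale_unit scale_right)
qed

lemma tri_le_r_imp_tri_le_c: "tri_le_r triple u e \<Longrightarrow> tri_le_c cscale triple u e"
  unfolding tri_le_r_def tri_le_c_def
  by (metis norm_minus_cancel norm_one scale_minus_left scale_one)

lemma tri_le_c_imp_tri_le_hc:
  assumes "tripotent triple u" and "tri_le_c cscale triple u e"
  shows "tri_le_hc cscale triple u e"
  using assms tri_le_imp_tri_le_h tripotent_scale_unit
  unfolding tri_le_c_def tri_le_hc_def by blast

lemma tri_le_h_imp_tri_le_hc: "tri_le_h triple u e \<Longrightarrow> tri_le_hc cscale triple u e"
  unfolding tri_le_hc_def by (metis norm_one scale_one)

lemma tri_le_hc_imp_tri_le_n:
  assumes "tripotent triple u" and "tripotent triple e" and "tri_le_hc cscale triple u e"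
  shows "tri_le_n triple u e"
  using assms tri_le_h_imp_tri_le_n tripotent_scale_unit tri_le_n_scale_unit
  unfolding tri_le_hc_def by blast

lemma tri_le_ht_imp_tri_le_hct: "tri_le_ht triple u e \<Longrightarrow> tri_le_hct cscale triple u e"
  unfolding tri_le_ht_def tri_le_hct_def
  by (erule tri_chain_mono) (rule tri_le_h_imp_tri_le_hc)

lemma tri_le_hct_imp_tri_le_nt: "tri_le_hct cscale triple u e \<Longrightarrow> tri_le_nt triple u e"
  unfolding tri_le_hct_def tri_le_nt_def
  by (erule tri_chain_mono) (rule tri_le_hc_imp_tri_le_n)

lemmas tri_le_implications =
  tri_le_imp_tri_le_r tri_le_r_imp_tri_le_c tri_le_h_imp_tri_le_hc tri_le_hc_imp_tri_le_n
  tri_le_ht_imp_tri_le_hct tri_le_hct_imp_tri_le_nt tri_le_nt_imp_tri_le_2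
  tri_le_r_imp_tri_le_h tri_le_c_imp_tri_le_hc
  tri_chain_single[where T = triple and R = "tri_le_h triple", folded tri_le_ht_def]
  tri_chain_single[where T = triple and R = "tri_le_hc cscale triple", folded tri_le_hct_def]
  tri_chain_single[where T = triple and R = "tri_le_n triple", folded tri_le_nt_def]

end

section \<open>Jordan algebras\<close>

locale jordan_algebra =
  fixes jprod :: "'a \<Rightarrow> 'a \<Rightarrow> 'a::real_vector" (infixl "\<odot>" 70)
  assumes jprod_commute: "x \<odot> y = y \<odot> x"
    and linear_jprod_left: "linear (\<lambda>x. x \<odot> y)"
    and jordan_axiom: "(x \<odot> y) \<odot> (x \<odot> x) = x \<odot> (y \<odot> (x \<odot> x))"
begin

lemma linear_jprod_right: "linear ((\<odot>) x)"
  using linear_jprod_left[of x] by (simp add: jprod_commute[of _ x])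

lemmas jprod_zero = linear_0[OF linear_jprod_left] linear_0[OF linear_jprod_right]
  and jprod_add = linear_add[OF linear_jprod_left] linear_add[OF linear_jprod_right]
  and jprod_diff = linear_diff[OF linear_jprod_left] linear_diff[OF linear_jprod_right]
  and jprod_scaleR = linear_scale[OF linear_jprod_left] linear_scale[OF linear_jprod_right]

lemma jordan_linearised:
  "(x \<odot> b) \<odot> (y \<odot> z) + (y \<odot> b) \<odot> (x \<odot> z) + (z \<odot> b) \<odot> (x \<odot> y) =
   x \<odot> (b \<odot> (y \<odot> z)) + y \<odot> (b \<odot> (x \<odot> z)) + z \<odot> (b \<odot> (x \<odot> y))"
  (is "?lhs = ?rhs")
proof -
  define F where "F x = (x \<odot> b) \<odot> (x \<odot> x) - x \<odot> (b \<odot> (x \<odot> x))" for x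
  have F_zero: "F x = 0" for x
    by (simp add: F_def jordan_axiom)
  have "2 *\<^sub>R (?lhs - ?rhs) =
      F (x + y + z) - F (x + y) - F (x + z) - F (y + z) + F x + F y + F z"
    by (simp add: F_def jprod_add jprod_commute algebra_simps scaleR_2)
  then show ?thesis
    by (simp add: F_zero)
qed

definition mult_commutator :: "'a \<Rightarrow> 'a \<Rightarrow> 'a \<Rightarrow> 'a" where
  "mult_commutator a b c = a \<odot> (b \<odot> c) - b \<odot> (a \<odot> c)"

lemma mult_commutator_cyclic:
  "mult_commutator x (y \<odot> z) b + mult_commutator y (x \<odot> z) b + mult_commutator z (x \<odot> y) b = 0"
  using jordan_linearised[of x b y z]
  by (simp add: mult_commutator_def jprod_commute algebra_simps)

text \<open>The left-hand side of the linearised Jordan identity runs over the three pairings of its four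
  variables, so its right-hand side is symmetric in all four of them as well.\<close>

lemma mult_commutator_derivation:
  "mult_commutator a b (x \<odot> y) = mult_commutator a b x \<odot> y + x \<odot> mult_commutator a b y"
proof -
  have "b \<odot> (a \<odot> (x \<odot> y)) + x \<odot> (a \<odot> (b \<odot> y)) + y \<odot> (a \<odot> (b \<odot> x)) =
      a \<odot> (b \<odot> (x \<odot> y)) + x \<odot> (b \<odot> (a \<odot> y)) + y \<odot> (b \<odot> (a \<odot> x))"
    unfolding jordan_linearised[symmetric]
    by (simp add: jprod_commute add_ac)
  then show ?thesis
    by (simp add: mult_commutator_def jprod_diff jprod_commute algebra_simps)
qed

abbreviation linear_triple :: "'a \<Rightarrow> 'a \<Rightarrow> 'a \<Rightarrow> 'a" where
  "linear_triple \<equiv> jordan_triple (\<odot>) (\<lambda>x. x)"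

lemma linear_triple_eq: "linear_triple x y z = (x \<odot> y) \<odot> z + mult_commutator x y z"
  by (simp add: jordan_triple_def mult_commutator_def jprod_commute algebra_simps)

lemma mult_commutator_linear_triple:
  "mult_commutator x y (linear_triple a b c) =
     linear_triple (mult_commutator x y a) b c + linear_triple a (mult_commutator x y b) c +
     linear_triple a b (mult_commutator x y c)"
proof -
  have "mult_commutator x y (v + w) = mult_commutator x y v + mult_commutator x y w"
    and "mult_commutator x y (v - w) = mult_commutator x y v - mult_commutator x y w" for v w
    by (simp_all add: mult_commutator_def jprod_add jprod_diff algebra_simps)
  then show ?thesis
    by (simp add: jordan_triple_def mult_commutator_derivation jprod_add jprod_diff
        del: diff_eq_eq)
qed

lemma jprod_linear_triple:
  "w \<odot> linear_triple a b c =
     linear_triple (w \<odot> a) b c - linear_triple a (w \<odot> b) c + linear_triple a b (w \<odot> c)"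
proof -
  have product: "w \<odot> ((a \<odot> b) \<odot> c) =
      (a \<odot> b) \<odot> (w \<odot> c) - mult_commutator a (w \<odot> b) c + mult_commutator (w \<odot> a) b c"
    using mult_commutator_cyclic[of w a b c] by (simp add: mult_commutator_def algebra_simps)
  have commutator: "w \<odot> mult_commutator a b c =
      mult_commutator a b (w \<odot> c) - (a \<odot> (w \<odot> b) - (w \<odot> a) \<odot> b) \<odot> c"
    using mult_commutator_derivation[of a b w c]
    by (simp add: mult_commutator_def[of a b w] jprod_commute)
  show ?thesis
    by (simp add: linear_triple_eq jprod_add jprod_diff product commutator)
qed

sublocale linear_triple: jordan_triple_system linear_triple
proof (rule jordan_triple_system.intro)
  fix x y z a b c
  show "linear_triple x y z = linear_triple z y x"
    by (simp add: jordan_triple_def jprod_commute algebra_simps)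
  show "linear (\<lambda>x. linear_triple x y z)" and "linear (\<lambda>y. linear_triple x y z)"
    by (auto intro!: linearI simp: jordan_triple_def jprod_add jprod_scaleR algebra_simps)
  have "linear_triple x y v = (x \<odot> y) \<odot> v + mult_commutator x y v"
    and "linear_triple y x v = (x \<odot> y) \<odot> v - mult_commutator x y v" for v
    by (simp_all add: linear_triple_eq mult_commutator_def jprod_commute)
  moreover have "linear_triple (v + w) b c = linear_triple v b c + linear_triple w b c"
    and "linear_triple a (v - w) c = linear_triple a v c - linear_triple a w c"
    and "linear_triple a b (v + w) = linear_triple a b v + linear_triple a b w" for v w
    by (simp_all add: jordan_triple_def jprod_add jprod_diff)
  ultimately show "linear_triple x y (linear_triple a b c) =
      linear_triple (linear_triple x y a) b c - linear_triple a (linear_triple y x b) c +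
      linear_triple a b (linear_triple x y c)"
    by (simp add: jprod_linear_triple mult_commutator_linear_triple)
qed

lemma mult_commutator_orthogonal_idempotent:
  assumes "u \<odot> u = u" and "f \<odot> u = 0"
  shows "mult_commutator f u x = 0"
  using mult_commutator_cyclic[of f u u x] assms by (simp add: mult_commutator_def jprod_zero)

end

locale jordan_star_algebra = jordan_algebra jprod
  for jprod :: "'a \<Rightarrow> 'a \<Rightarrow> 'a::real_vector" (infixl "\<odot>" 70) +
  fixes star :: "'a \<Rightarrow> 'a"
  assumes linear_star: "linear star"
    and star_involutive: "star (star x) = x"
    and star_jprod: "star (x \<odot> y) = star y \<odot> star x"
begin

lemma jordan_triple_eq_linear_triple:
  "jordan_triple (\<odot>) star x y z = linear_triple x (star y) z"
  by (simp add: jordan_triple_def)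

lemma star_linear_triple:
  "star (linear_triple x y z) = linear_triple (star x) (star y) (star z)"
  by (simp add: jordan_triple_def linear_add[OF linear_star] linear_diff[OF linear_star]
      star_jprod jprod_commute)

sublocale star_triple: jordan_triple_system "jordan_triple (\<odot>) star"
  using linear_triple.twist_by_involution[OF linear_star star_involutive star_linear_triple]
  by (simp flip: jordan_triple_eq_linear_triple)

lemma tripotent_projection:
  assumes "jprojection (\<odot>) star p"
  shows "tripotent (jordan_triple (\<odot>) star) p"
  using assms by (simp add: jprojection_def tripotent_def jordan_triple_def)

lemma projection_tri_le_2_imp_tri_le:
  assumes e: "jprojection (\<odot>) star e" and u: "jprojection (\<odot>) star u"
    and "tri_le_2 (jordan_triple (\<odot>) star) u e"
  shows "tri_le (jordan_triple (\<odot>) star) u e"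
proof -
  have idempotent: "e \<odot> e = e" "u \<odot> u = u" and self_adjoint: "star e = e" "star u = u"
    using e u by (simp_all add: jprojection_def)
  have absorb: "e \<odot> u = u"
    using assms(3)
    by (simp add: tri_le_2_def peirce2_def jordan_triple_def idempotent self_adjoint jprod_commute)
  have "jprojection (\<odot>) star (e - u)"
    by (simp add: jprojection_def linear_diff[OF linear_star] jprod_diff idempotent self_adjoint
        absorb jprod_commute)
  then have "tripotent (jordan_triple (\<odot>) star) (e - u)"
    by (rule tripotent_projection)
  moreover have "(e - u) \<odot> u = 0"
    by (simp add: jprod_diff idempotent absorb)
  then have "tri_orthogonal (jordan_triple (\<odot>) star) (e - u) u"
    by (simp add: tri_orthogonal_def jordan_triple_eq_linear_triple linear_triple_eq idempotent
        self_adjoint jprod_zero mult_commutator_orthogonal_idempotent)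
  ultimately show ?thesis
    by (simp add: tri_le_def)
qed

end

section \<open>JB*-triples and JB*-algebras\<close>

lemma (in complex_banach_space) linear_if_real_homogeneous:
  assumes "\<And>x y. f (x + y) = f x + f y"
    and "\<And>r x. f (cscale (complex_of_real r) x) = cscale (complex_of_real r) (f x)"
  shows "linear f"
  using assms by (intro linearI) (simp_all add: scale_of_real)

lemma (in complex_banach_space) complex_linear_imp_linear:
  "Vector_Spaces.linear cscale cscale f \<Longrightarrow> linear f"
  by (rule linear_if_real_homogeneous) (simp_all add: Vector_Spaces.linear_iff)

sublocale jbstar_triple \<subseteq> complex_jordan_triple_system cscale triple
proof (intro complex_jordan_triple_system.intro jordan_triple_system.intro
    complex_jordan_triple_system_axioms.intro vector_space_axioms)
  show "linear (\<lambda>y. triple x y z)" for x z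
    by (rule linear_if_real_homogeneous) (simp_all add: triple_add_middle triple_scale_middle)
  show "triple (cscale c x) y z = cscale c (triple x y z)" for c x y z
    using triple_linear by (simp add: Vector_Spaces.linear_iff)
qed (rule triple_sym complex_linear_imp_linear[OF triple_linear] jordan_identity
    triple_scale_middle)+

sublocale jbstar_algebra \<subseteq> jordan_star_algebra jmult star
proof (intro jordan_star_algebra.intro jordan_algebra.intro jordan_star_algebra_axioms.intro)
  show "linear star"
    by (rule linear_if_real_homogeneous) (simp_all add: star_add star_scale)
qed (rule jmult_commute complex_linear_imp_linear[OF jmult_linear] jmult_jordan star_star
    star_jmult)+

sublocale jbstar_algebra \<subseteq>
  star_triple: complex_jordan_triple_system cscale "jordan_triple jmult star"
proof
  have scale_jmult: "jmult (cscale c x) y = cscale c (jmult x y)"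
    "jmult x (cscale c y) = cscale c (jmult x y)" for c x y
    using jmult_linear by (simp_all add: Vector_Spaces.linear_iff jmult_commute[of x])
  show "jordan_triple jmult star (cscale c x) y z = cscale c (jordan_triple jmult star x y z)"
    and "jordan_triple jmult star x (cscale c y) z = cscale (cnj c) (jordan_triple jmult star x y z)"
    for c x y z
    by (simp_all add: jordan_triple_def scale_jmult star_scale scale_right_distrib
        scale_right_diff_distrib)
qed

theorem proposition2p18:
  fixes cscale :: "complex \<Rightarrow> 'a::banach \<Rightarrow> 'a"
    and T :: "'a \<Rightarrow> 'a \<Rightarrow> 'a \<Rightarrow> 'a"
    and jmult :: "'a \<Rightarrow> 'a \<Rightarrow> 'a"
    and star :: "'a \<Rightarrow> 'a"
    and e u :: 'a
  shows
    "(jbstar_triple cscale T \<and> tripotent T e \<and> tripotent T u \<longrightarrow>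
        (tri_le T u e \<longrightarrow> tri_le_r T u e) \<and>
        (tri_le_r T u e \<longrightarrow> tri_le_c cscale T u e) \<and>
        (tri_le_h T u e \<longrightarrow> tri_le_hc cscale T u e) \<and>
        (tri_le_hc cscale T u e \<longrightarrow> tri_le_n T u e) \<and>
        (tri_le_ht T u e \<longrightarrow> tri_le_hct cscale T u e) \<and>
        (tri_le_hct cscale T u e \<longrightarrow> tri_le_nt T u e) \<and>
        (tri_le_nt T u e \<longrightarrow> tri_le_2 T u e) \<and>
        (tri_le_r T u e \<longrightarrow> tri_le_h T u e) \<and>
        (tri_le_c cscale T u e \<longrightarrow> tri_le_hc cscale T u e) \<and>
        (tri_le_h T u e \<longrightarrow> tri_le_ht T u e) \<and>
        (tri_le_hc cscale T u e \<longrightarrow> tri_le_hct cscale T u e) \<and>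
        (tri_le_n T u e \<longrightarrow> tri_le_nt T u e)) \<and>
     (jbstar_algebra cscale jmult star \<and> T = jordan_triple jmult star \<and>
      jprojection jmult star e \<and> jprojection jmult star u \<longrightarrow>
        (tri_le T u e \<longleftrightarrow> tri_le_r T u e) \<and>
        (tri_le T u e \<longleftrightarrow> tri_le_c cscale T u e) \<and>
        (tri_le T u e \<longleftrightarrow> tri_le_h T u e) \<and>
        (tri_le T u e \<longleftrightarrow> tri_le_hc cscale T u e) \<and>
        (tri_le T u e \<longleftrightarrow> tri_le_n T u e) \<and>
        (tri_le T u e \<longleftrightarrow> tri_le_ht T u e) \<and>
        (tri_le T u e \<longleftrightarrow> tri_le_hct cscale T u e) \<and>
        (tri_le T u e \<longleftrightarrow> tri_le_nt T u e) \<and>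
        (tri_le T u e \<longleftrightarrow> tri_le_2 T u e))"
  (is "(_ \<longrightarrow> ?implications) \<and> (_ \<longrightarrow> ?equivalences)")
proof (rule conjI; rule impI; elim conjE)
  assume "jbstar_triple cscale T" and e: "tripotent T e" and u: "tripotent T u"
  then interpret jbstar_triple cscale T
    by simp
  show ?implications
    by (intro conjI impI) (blast intro: e u tri_le_implications)+
next
  assume "jbstar_algebra cscale jmult star" and T: "T = jordan_triple jmult star"
    and e: "jprojection jmult star e" and u: "jprojection jmult star u"
  then interpret jbstar_algebra cscale jmult star
    by simp
  have tripotents: "tripotent T e" "tripotent T u"
    using tripotent_projection e u by (simp_all add: T)
  have le_2_imp_le: "tri_le_2 T u e \<Longrightarrow> tri_le T u e"
    unfolding T by (rule projection_tri_le_2_imp_tri_le[OF e u])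
  show ?equivalences
    by (intro conjI iffI)
      (blast intro: tripotents le_2_imp_le star_triple.tri_le_implications[folded T])+
qed

end
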